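(* Let $u$ be continuous and homogeneous of degree $d>0$, $v=-\log u$. Then the conjugate function $v_*$ is $d$-logarithmically homogeneous, and the dual function $f$ satisfies $$f(p)=v_*(p)+d+d\log(w)-d\log(d);$$ that is, $f$ is also $d$-logarithmically homogeneous. Furthermore, if $x(p)$ is the best-response function of the logarithmic utility maximization problem (LUMP), i.e. the solution of $\max\{-v(x):x\in\mathcal X,\langle p,x\rangle\le w\}$, then it is also the best response of the utility maximization problem (UMP) $\max\{u(x):x\in\mathcal X,\langle p,x\rangle\le w\}$. Besides, $$\nabla f(p)=-\frac dw\,x(p).$$
   Context: $\mathcal X\subseteq\mathbb R^n_+$ is a closed convex cone, $w>0$ a budget, $p>0$ a price vector, and $u:\mathcal X\to\mathbb R_+$ a utility function (with $-\log 0=+\infty$). Standing assumption: $u$ is differentiable and strictly concave, and the best response $x(p)$ is unique. Definitions: $$f(p)=\max\{-v(x):x\in\mathcal X,\ \langle p,x\rangle\le w\},\qquad v_*(p)=\max_{x\in\mathcal X}\{-\langle p,x\rangle-v(x)\}.$$ A function $g$ is $d$-logarithmically homogeneous if $g(\alpha y)=g(y)-d\log\alpha$ for all $\alpha>0$. *)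

theory Defs
  imports "HOL-Analysis.Analysis"
begin

definition pos_orthant :: "(real ^ 'n) set" where
  "pos_orthant = {p. \<forall>i. 0 < p $ i}"

definition strictly_concave_on :: "'a::real_vector set \<Rightarrow> ('a \<Rightarrow> real) \<Rightarrow> bool" where
  "strictly_concave_on S f \<longleftrightarrow> convex S \<and>
     (\<forall>x\<in>S. \<forall>y\<in>S. \<forall>t. x \<noteq> y \<and> 0 < t \<and> t < 1 \<longrightarrow>
        (1 - t) * f x + t * f y < f ((1 - t) *\<^sub>R x + t *\<^sub>R y))"

text \<open>Homogeneity is required for positive factors only; real powers allow non-integer degrees.\<close>

definition homogeneous_on :: "'a::real_vector set \<Rightarrow> real \<Rightarrow> ('a \<Rightarrow> real) \<Rightarrow> bool" where
  "homogeneous_on S d u \<longleftrightarrow> (\<forall>\<alpha>>0. \<forall>x\<in>S. u (\<alpha> *\<^sub>R x) = \<alpha> powr d * u x)"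

definition log_homogeneous_on :: "'a::real_vector set \<Rightarrow> real \<Rightarrow> ('a \<Rightarrow> ereal) \<Rightarrow> bool" where
  "log_homogeneous_on S d g \<longleftrightarrow>
     (\<forall>\<alpha>>0. \<forall>y\<in>S. g (\<alpha> *\<^sub>R y) = g y - ereal (d * ln \<alpha>))"

text \<open>The convention \<open>- log 0 = +\<infinity>\<close>; the real function \<^const>\<open>ln\<close> has \<open>ln 0 = 0\<close>.
  Only arguments \<open>t \<ge> 0\<close> are relevant.\<close>

definition neg_log :: "real \<Rightarrow> ereal" where
  "neg_log t = (if t = 0 then \<infinity> else ereal (- ln t))"

definition budget_set :: "(real ^ 'n) set \<Rightarrow> real \<Rightarrow> real ^ 'n \<Rightarrow> (real ^ 'n) set" where
  "budget_set X w p = {x \<in> X. p \<bullet> x \<le> w}"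

text \<open>Both maxima are written as suprema of extended-real functions. Attainment is not part of
  these definitions: it has to be assumed or proved where they are used.\<close>

definition dual_fun ::
  "(real ^ 'n) set \<Rightarrow> real \<Rightarrow> (real ^ 'n \<Rightarrow> ereal) \<Rightarrow> real ^ 'n \<Rightarrow> ereal" where
  "dual_fun X w v p = (SUP x \<in> budget_set X w p. - v x)"

definition conj_fun ::
  "(real ^ 'n) set \<Rightarrow> (real ^ 'n \<Rightarrow> ereal) \<Rightarrow> real ^ 'n \<Rightarrow> ereal" where
  "conj_fun X v p = (SUP x \<in> X. ereal (- (p \<bullet> x)) - v x)"

text \<open>\<open>y\<close> is the best response at \<open>p\<close> for the objective \<open>h\<close>: the one and only maximizer of \<open>h\<close>
  over the budget set.\<close>

definition is_best_response ::
  "(real ^ 'n) set \<Rightarrow> real \<Rightarrow> (real ^ 'n \<Rightarrow> 'b::ord) \<Rightarrow> real ^ 'n \<Rightarrow> real ^ 'n \<Rightarrow> bool" where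
  "is_best_response X w h p y \<longleftrightarrow>
     (\<forall>z. is_arg_max h (\<lambda>x. x \<in> budget_set X w p) z \<longleftrightarrow> z = y)"

end

theory Submission
  imports Defs
begin

text \<open>
  Everything rests on one inequality. Write \<open>y\<close> for a best response at the price \<open>p\<close>. Any
  \<open>z \<noteq> 0\<close> in the cone can be rescaled to \<open>(w / p \<bullet> z) z\<close>, which costs exactly the budget, so
  homogeneity turns the optimality of \<open>y\<close> within the budget set into
  \<open>u z \<le> (p \<bullet> z / w)\<^sup>d u y\<close> on the whole cone (\<open>utility_le_rescaled_best\<close>).

  \<^item> \<^emph>\<open>Conjugate.\<close> Taking logarithms, \<open>- p \<bullet> z + ln (u z) \<le> ln (u y) + (d ln (t / w) - t)\<close> with
    \<open>t = p \<bullet> z\<close>. The bracket is largest at \<open>t = d\<close>, and the value there is attained at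
    \<open>z = (d / w) y\<close> because the whole budget is spent at \<open>y\<close>. Since \<open>ln (u y)\<close> is the dual
    value, this is the relation between the dual function and the conjugate, and it shows that
    the conjugate is attained. Logarithmic homogeneity of the conjugate is the substitution
    \<open>z \<mapsto> \<alpha> z\<close> in the supremum; the dual function inherits it.

  \<^item> \<^emph>\<open>Gradient.\<close> Put \<open>F q = ln (u (x q))\<close>. The inequality at the price \<open>q\<close> with \<open>z = x p\<close> gives,
    through \<open>ln s \<le> s - 1\<close>, that \<open>- (d / w) x p\<close> is a subgradient of \<open>F\<close> at \<open>p\<close>. A function with
    a continuous selection of subgradients is differentiable with that selection as its gradient
    (\<open>gderiv_of_continuous_subgradient\<close>), so only the continuity of the best response is left.
    It follows from compactness and uniqueness: best responses at prices near \<open>p\<close> stay in a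
    compact set, and the inequality shows that each limit point of them is optimal at \<open>p\<close>.

  Strict concavity enters through one consequence only: the utility is positive away from the
  origin. Hence the values are finite as soon as the cone has a nonzero point; on the zero cone
  both suprema are \<open>-\<infinity>\<close>.
\<close>

section \<open>Gradients from continuous subgradients\<close>

text \<open>The subgradient inequality at \<open>p\<close> bounds the remainder \<open>F q - F p - G p \<bullet> (q - p)\<close> from
  below by \<open>0\<close>; the one at \<open>q\<close> bounds it from above by \<open>(G q - G p) \<bullet> (q - p)\<close>, which is
  \<open>o(norm (q - p))\<close> because \<open>G\<close> is continuous.\<close>

lemma gderiv_of_continuous_subgradient:
  fixes F :: "'a::real_inner \<Rightarrow> real" and G :: "'a \<Rightarrow> 'a"
  assumes S: "open S" "p \<in> S"
    and sub: "\<And>a b. a \<in> S \<Longrightarrow> b \<in> S \<Longrightarrow> G a \<bullet> (b - a) \<le> F b - F a"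
    and cont: "continuous_on S G"
  shows "GDERIV F p :> G p"
proof -
  obtain e where e: "0 < e" "\<And>q. dist q p < e \<Longrightarrow> q \<in> S"
    using S by (metis open_dist)
  have "isCont G p"
    using S cont by (simp add: continuous_on_eq_continuous_at)
  then have lim: "((\<lambda>q. norm (G q - G p)) \<longlongrightarrow> 0) (at p)"
    by (simp add: isCont_def LIM_zero tendsto_norm_zero)
  have "(F has_derivative (\<lambda>h. h \<bullet> G p)) (at p)"
  proof (rule has_derivativeI_sandwich[OF e(1) _ _ lim])
    show "bounded_linear (\<lambda>h. h \<bullet> G p)"
      by (rule bounded_linear_inner_left)
    fix q assume q: "q \<noteq> p" "dist q p < e"
    have "G p \<bullet> (q - p) \<le> F q - F p" "G q \<bullet> (p - q) \<le> F p - F q"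
      using sub e(2)[OF q(2)] S(2) by blast+
    then have "0 \<le> F q - F p - (q - p) \<bullet> G p"
      and "F q - F p - (q - p) \<bullet> G p \<le> (G q - G p) \<bullet> (q - p)"
      by (simp_all add: inner_diff inner_commute)
    moreover have "(G q - G p) \<bullet> (q - p) \<le> norm (G q - G p) * norm (q - p)"
      by (rule norm_cauchy_schwarz)
    ultimately show "norm (F q - F p - (q - p) \<bullet> G p) / norm (q - p) \<le> norm (G q - G p)"
      using q(1) by (simp add: divide_le_eq)
  qed
  then show ?thesis
    by (simp add: gderiv_def)
qed

section \<open>The extended logarithm\<close>

lemma neg_log_less_iff:
  assumes "0 \<le> s" "0 \<le> t"
  shows "- neg_log s < - neg_log t \<longleftrightarrow> s < t"
  using assms by (auto simp: neg_log_def)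

lemma neg_log_mult:
  assumes "0 < c" "0 \<le> t"
  shows "neg_log (c * t) = neg_log t - ereal (ln c)"
  using assms by (auto simp: neg_log_def ln_mult)

text \<open>The logarithmic and the original problem have the same maximizers because the extended
  logarithm is strictly increasing, the value \<open>-\<infinity>\<close> at \<open>0\<close> included.\<close>

lemma is_best_response_neg_log_iff:
  assumes "\<forall>y\<in>X. 0 \<le> u y"
  shows "is_best_response X w (\<lambda>y. - neg_log (u y)) p y \<longleftrightarrow> is_best_response X w u p y"
proof -
  have "is_arg_max (\<lambda>y. - neg_log (u y)) (\<lambda>x. x \<in> budget_set X w p) z \<longleftrightarrow>
      is_arg_max u (\<lambda>x. x \<in> budget_set X w p) z" for z
    using assms neg_log_less_iff by (auto simp: is_arg_max_def budget_set_def)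
  then show ?thesis
    by (simp add: is_best_response_def)
qed

lemma is_best_response_iff:
  fixes u :: "real ^ 'n \<Rightarrow> real"
  shows "is_best_response X w u p y \<longleftrightarrow>
    y \<in> X \<and> p \<bullet> y \<le> w \<and> (\<forall>z\<in>X. p \<bullet> z \<le> w \<longrightarrow> u z \<le> u y) \<and>
    (\<forall>z\<in>X. p \<bullet> z \<le> w \<longrightarrow> u y \<le> u z \<longrightarrow> z = y)"
proof
  assume "is_best_response X w u p y"
  then have y: "is_arg_max u (\<lambda>x. x \<in> budget_set X w p) y"
    and unique: "\<And>z. is_arg_max u (\<lambda>x. x \<in> budget_set X w p) z \<Longrightarrow> z = y"
    by (auto simp: is_best_response_def)
  have max: "\<forall>z\<in>X. p \<bullet> z \<le> w \<longrightarrow> u z \<le> u y"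
    using y by (auto simp: is_arg_max_def budget_set_def not_less)
  have "z = y" if "z \<in> X" "p \<bullet> z \<le> w" "u y \<le> u z" for z
    using that max by (intro unique) (force simp: is_arg_max_def budget_set_def)
  with y max show "y \<in> X \<and> p \<bullet> y \<le> w \<and> (\<forall>z\<in>X. p \<bullet> z \<le> w \<longrightarrow> u z \<le> u y) \<and>
    (\<forall>z\<in>X. p \<bullet> z \<le> w \<longrightarrow> u y \<le> u z \<longrightarrow> z = y)"
    by (auto simp: is_arg_max_def budget_set_def)
next
  assume "y \<in> X \<and> p \<bullet> y \<le> w \<and> (\<forall>z\<in>X. p \<bullet> z \<le> w \<longrightarrow> u z \<le> u y) \<and>
    (\<forall>z\<in>X. p \<bullet> z \<le> w \<longrightarrow> u y \<le> u z \<longrightarrow> z = y)"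
  then show "is_best_response X w u p y"
    unfolding is_best_response_def is_arg_max_def budget_set_def mem_Collect_eq
    by (metis linorder_not_less)
qed

section \<open>Positive prices\<close>

text \<open>The smallest price serves as the constant: on nonnegative vectors the Euclidean norm is at
  most the sum of the entries.\<close>

lemma pos_orthant_inner_ge:
  fixes p :: "real ^ 'n"
  assumes "p \<in> pos_orthant"
  obtains m where "0 < m" "\<And>y. \<forall>i. 0 \<le> y $ i \<Longrightarrow> m * norm y \<le> p \<bullet> y"
proof
  let ?m = "Min (range (($) p))"
  show "0 < ?m"
    using assms by (auto simp: pos_orthant_def)
  fix y :: "real ^ 'n" assume y: "\<forall>i. 0 \<le> y $ i"
  have "?m * norm y \<le> ?m * (\<Sum>i\<in>UNIV. \<bar>y $ i\<bar>)"
    using \<open>0 < ?m\<close> norm_le_l1_cart[of y] by (intro mult_left_mono less_imp_le[of 0])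
  also have "\<dots> = (\<Sum>i\<in>UNIV. ?m * y $ i)"
    using y by (simp add: sum_distrib_left)
  also have "\<dots> \<le> (\<Sum>i\<in>UNIV. p $ i * y $ i)"
    using y by (intro sum_mono mult_right_mono) auto
  finally show "?m * norm y \<le> p \<bullet> y"
    by (simp add: inner_vec_def)
qed

lemma pos_orthant_inner_pos:
  assumes "p \<in> pos_orthant" "\<forall>i. 0 \<le> y $ i" "y \<noteq> 0"
  shows "0 < p \<bullet> y"
proof -
  obtain m where "0 < m" "m * norm y \<le> p \<bullet> y"
    using pos_orthant_inner_ge assms by metis
  moreover have "0 < m * norm y"
    using \<open>0 < m\<close> assms(3) by simp
  ultimately show ?thesis
    by linarith
qed

lemma open_pos_orthant: "open (pos_orthant :: (real ^ 'n) set)"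
proof -
  have "pos_orthant = (\<Inter>i. {p :: real ^ 'n. 0 < p $ i})"
    by (auto simp: pos_orthant_def)
  moreover have "open (\<Inter>i. {p :: real ^ 'n. 0 < p $ i})"
    by (intro open_INT ballI finite open_Collect_less continuous_intros)
  ultimately show ?thesis
    by simp
qed

section \<open>Homogeneous utilities on a cone\<close>

locale homogeneous_utility =
  fixes X :: "(real ^ 'n) set" and u :: "real ^ 'n \<Rightarrow> real" and w d :: real
  assumes cone: "convex_cone X"
    and nonneg: "\<And>y. y \<in> X \<Longrightarrow> \<forall>i. 0 \<le> y $ i"
    and w: "0 < w" and d: "0 < d"
    and u_nonneg: "\<And>y. y \<in> X \<Longrightarrow> 0 \<le> u y"
    and strict: "strictly_concave_on X u"
    and homogeneous: "homogeneous_on X d u"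
begin

lemma zero_in: "0 \<in> X"
  by (rule convex_cone_contains_0[OF cone])

lemma scaled_in: "0 \<le> c \<Longrightarrow> y \<in> X \<Longrightarrow> c *\<^sub>R y \<in> X"
  by (rule convex_cone_scaleR[OF cone])

lemma utility_scaled: "0 < c \<Longrightarrow> y \<in> X \<Longrightarrow> u (c *\<^sub>R y) = c powr d * u y"
  using homogeneous by (simp add: homogeneous_on_def)

lemma cost_pos: "p \<in> pos_orthant \<Longrightarrow> y \<in> X \<Longrightarrow> y \<noteq> 0 \<Longrightarrow> 0 < p \<bullet> y"
  by (rule pos_orthant_inner_pos[OF _ nonneg])

lemma cost_nonneg: "p \<in> pos_orthant \<Longrightarrow> y \<in> X \<Longrightarrow> 0 \<le> p \<bullet> y"
  using cost_pos by (cases "y = 0") (auto intro: less_imp_le)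

text \<open>Doubling the argument multiplies \<open>u 0\<close> by \<open>2 powr d\<close>, which differs from \<open>1\<close>.\<close>

lemma utility_zero: "u 0 = 0"
proof -
  have "u 0 = 2 powr d * u 0"
    using utility_scaled[of 2 0] zero_in by simp
  moreover have "2 powr d \<noteq> (1::real)"
    using d by simp
  ultimately show ?thesis
    by simp
qed

text \<open>A nonzero \<open>y\<close> is the midpoint of \<open>0\<close> and \<open>2 y\<close>, where the utility is nonnegative.\<close>

lemma utility_pos:
  assumes "y \<in> X" "y \<noteq> 0"
  shows "0 < u y"
proof -
  have "2 *\<^sub>R y \<in> X"
    using assms by (simp add: scaled_in)
  moreover from this have "(1 - 1/2) * u 0 + 1/2 * u (2 *\<^sub>R y)
      < u ((1 - 1/2) *\<^sub>R 0 + (1/2) *\<^sub>R (2 *\<^sub>R y))"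
    using strict[unfolded strictly_concave_on_def, THEN conjunct2, rule_format,
        of 0 "2 *\<^sub>R y" "1/2"] zero_in assms(2)
    by simp
  ultimately show ?thesis
    using u_nonneg[of "2 *\<^sub>R y"] utility_zero by simp
qed

text \<open>For \<open>z = 0\<close> both sides vanish, since \<open>0 powr d = 0\<close>.\<close>

lemma utility_le_rescaled_best:
  assumes p: "p \<in> pos_orthant" and y: "is_best_response X w u p y" and z: "z \<in> X"
  shows "u z \<le> (p \<bullet> z / w) powr d * u y"
proof (cases "z = 0")
  case True
  then show ?thesis
    by (simp add: utility_zero)
next
  case False
  then have t: "0 < p \<bullet> z"
    using cost_pos p z by blast
  let ?c = "p \<bullet> z / w" and ?z = "(w / (p \<bullet> z)) *\<^sub>R z"
  have "?z \<in> X" "p \<bullet> ?z \<le> w"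
    using t w z by (auto intro: scaled_in)
  then have "u ?z \<le> u y"
    using y by (simp add: is_best_response_iff)
  moreover have "u z = ?c powr d * u ?z"
    using utility_scaled[of ?c ?z] \<open>?z \<in> X\<close> t w by simp
  ultimately show ?thesis
    by (simp add: mult_left_mono)
qed

lemma best_response_in:
  assumes "is_best_response X w u p y"
  shows "y \<in> X" "p \<bullet> y \<le> w"
  using assms by (simp_all add: is_best_response_iff)

text \<open>A multiple of any nonzero point of the cone is affordable and has positive utility.\<close>

lemma best_response_nonzero:
  assumes p: "p \<in> pos_orthant" and y: "is_best_response X w u p y" and X: "X \<noteq> {0}"
  shows "y \<noteq> 0"
proof -
  obtain z where z: "z \<in> X" "z \<noteq> 0"
    using X zero_in by blast
  then have "0 < (p \<bullet> z / w) powr d * u y"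
    using utility_pos utility_le_rescaled_best[OF p y] by force
  then show ?thesis
    using utility_zero by auto
qed

lemma best_response_spends_budget:
  assumes p: "p \<in> pos_orthant" and y: "is_best_response X w u p y" and X: "X \<noteq> {0}"
  shows "p \<bullet> y = w"
proof (rule ccontr)
  assume "p \<bullet> y \<noteq> w"
  have yX: "y \<in> X" "p \<bullet> y \<le> w" "y \<noteq> 0"
    using best_response_in best_response_nonzero assms by auto
  \<comment> \<open>Unspent budget would make the factor in \<open>utility_le_rescaled_best\<close> for \<open>z = y\<close> less than \<open>1\<close>.\<close>
  then have "0 < p \<bullet> y / w" "p \<bullet> y / w < 1"
    using cost_pos[OF p] \<open>p \<bullet> y \<noteq> w\<close> w by auto
  then have "(p \<bullet> y / w) powr d < 1"
    using d powr_less_mono2[of d "p \<bullet> y / w" 1] by simp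
  then have "(p \<bullet> y / w) powr d * u y < u y"
    using utility_pos yX by simp
  then show False
    using utility_le_rescaled_best[OF p y yX(1)] by simp
qed

lemma ln_utility_le:
  assumes p: "p \<in> pos_orthant" and y: "is_best_response X w u p y"
    and z: "z \<in> X" "z \<noteq> 0"
  shows "ln (u z) \<le> ln (u y) + d * ln (p \<bullet> z / w)"
proof -
  have "0 < p \<bullet> z / w" "0 < u z"
    using cost_pos p z w utility_pos by auto
  moreover have "0 < u y"
    using best_response_in(1)[OF y] best_response_nonzero[OF p y] z utility_pos by blast
  ultimately have "ln (u z) \<le> ln ((p \<bullet> z / w) powr d * u y)"
    using utility_le_rescaled_best[OF p y z(1)] by simp
  also have "\<dots> = d * ln (p \<bullet> z / w) + ln (u y)"
    using \<open>0 < u y\<close> \<open>0 < p \<bullet> z / w\<close> by (subst ln_mult) (auto simp: ln_powr)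
  finally show ?thesis
    by simp
qed

section \<open>Dual function and conjugate\<close>

lemma dual_fun_eq_best:
  assumes y: "is_best_response X w u p y"
  shows "dual_fun X w (\<lambda>y. neg_log (u y)) p = - neg_log (u y)"
  unfolding dual_fun_def
proof (rule SUP_eqI)
  fix z assume "z \<in> budget_set X w p"
  then show "- neg_log (u z) \<le> - neg_log (u y)"
    using y neg_log_less_iff[of "u y" "u z"] u_nonneg
    by (auto simp: is_best_response_iff budget_set_def not_less[symmetric])
next
  fix b assume "\<And>z. z \<in> budget_set X w p \<Longrightarrow> - neg_log (u z) \<le> b"
  then show "- neg_log (u y) \<le> b"
    using y by (simp add: is_best_response_iff budget_set_def)
qed

lemma dual_fun_eq_ln:
  assumes "p \<in> pos_orthant" "is_best_response X w u p y" "X \<noteq> {0}"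
  shows "dual_fun X w (\<lambda>y. neg_log (u y)) p = ereal (ln (u y))"
  using dual_fun_eq_best[OF assms(2)] best_response_nonzero[OF assms]
    utility_pos[OF best_response_in(1)[OF assms(2)]]
  by (auto simp: neg_log_def)

text \<open>The bound combines \<open>ln_utility_le\<close> with the maximization of \<open>d ln t - t\<close> over \<open>t > 0\<close>, whose
  maximum is at \<open>t = d\<close>; that maximization is \<open>ln s \<le> s - 1\<close> for \<open>s = t / d\<close>.\<close>

lemma conj_objective_le:
  assumes p: "p \<in> pos_orthant" and y: "is_best_response X w u p y" and z: "z \<in> X"
  shows "ereal (- (p \<bullet> z)) - neg_log (u z) \<le> ereal (ln (u y) - (d + d * ln w - d * ln d))"
proof (cases "z = 0")
  case True
  then show ?thesis
    by (simp add: utility_zero neg_log_def)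
next
  case False
  then have t: "0 < p \<bullet> z"
    using cost_pos p z by blast
  have "ln (p \<bullet> z / d) \<le> p \<bullet> z / d - 1"
    using t d by (intro ln_le_minus_one) simp
  then have "d * ln (p \<bullet> z / d) \<le> p \<bullet> z - d"
    using d by (simp add: field_simps)
  then have "d * ln (p \<bullet> z) - d * ln d \<le> p \<bullet> z - d"
    using t d by (simp add: ln_div right_diff_distrib)
  moreover have "ln (u z) \<le> ln (u y) + (d * ln (p \<bullet> z) - d * ln w)"
    using ln_utility_le[OF p y z False] t w by (simp add: ln_div right_diff_distrib)
  ultimately show ?thesis
    using utility_pos[OF z False] by (simp add: neg_log_def)
qed

lemma conj_objective_at_rescaled_best:
  assumes p: "p \<in> pos_orthant" and y: "is_best_response X w u p y" and X: "X \<noteq> {0}"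
  shows "ereal (- (p \<bullet> ((d / w) *\<^sub>R y))) - neg_log (u ((d / w) *\<^sub>R y))
    = ereal (ln (u y) - (d + d * ln w - d * ln d))"
proof -
  have "y \<in> X"
    using best_response_in y by blast
  moreover have "0 < u y"
    using utility_pos best_response_nonzero[OF p y X] \<open>y \<in> X\<close> by blast
  ultimately have "u ((d / w) *\<^sub>R y) = (d / w) powr d * u y" "0 < (d / w) powr d * u y"
    using d w by (simp_all add: utility_scaled)
  then show ?thesis
    using best_response_spends_budget[OF p y X] d w \<open>0 < u y\<close>
    by (simp add: neg_log_def ln_mult ln_powr ln_div right_diff_distrib)
qed

lemma conj_fun_attained:
  assumes p: "p \<in> pos_orthant" and y: "is_best_response X w u p y"
  shows "\<exists>y. is_arg_max (\<lambda>z. ereal (- (p \<bullet> z)) - neg_log (u z)) (\<lambda>z. z \<in> X) y"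
proof (cases "X = {0}")
  case True
  then show ?thesis
    by (auto simp: is_arg_max_def)
next
  case False
  have "(d / w) *\<^sub>R y \<in> X"
    using best_response_in(1)[OF y] d w by (simp add: scaled_in)
  then have "is_arg_max (\<lambda>z. ereal (- (p \<bullet> z)) - neg_log (u z)) (\<lambda>z. z \<in> X) ((d / w) *\<^sub>R y)"
    using conj_objective_le[OF p y]
    unfolding is_arg_max_def conj_objective_at_rescaled_best[OF p y False]
    by (auto simp: not_less)
  then show ?thesis
    by blast
qed

lemma dual_fun_eq_conj_fun:
  assumes p: "p \<in> pos_orthant" and y: "is_best_response X w u p y"
  shows "dual_fun X w (\<lambda>y. neg_log (u y)) p
    = conj_fun X (\<lambda>y. neg_log (u y)) p + ereal (d + d * ln w - d * ln d)"
proof (cases "X = {0}")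
  case True
  then have "y = 0"
    using best_response_in(1)[OF y] by simp
  then show ?thesis
    unfolding dual_fun_eq_best[OF y] by (simp add: True conj_fun_def utility_zero neg_log_def)
next
  case False
  have yX: "(d / w) *\<^sub>R y \<in> X"
    using best_response_in(1)[OF y] d w by (simp add: scaled_in)
  have "conj_fun X (\<lambda>y. neg_log (u y)) p = ereal (ln (u y) - (d + d * ln w - d * ln d))"
    unfolding conj_fun_def
  proof (rule SUP_eqI)
    show "ereal (- (p \<bullet> z)) - neg_log (u z) \<le> ereal (ln (u y) - (d + d * ln w - d * ln d))"
      if "z \<in> X" for z
      by (rule conj_objective_le[OF p y that])
    show "ereal (ln (u y) - (d + d * ln w - d * ln d)) \<le> b"
      if "\<And>z. z \<in> X \<Longrightarrow> ereal (- (p \<bullet> z)) - neg_log (u z) \<le> b" for b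
      using that[OF yX] unfolding conj_objective_at_rescaled_best[OF p y False] .
  qed
  then show ?thesis
    by (simp add: dual_fun_eq_ln[OF p y False])
qed

lemma log_homogeneous_conj_fun: "log_homogeneous_on S d (conj_fun X (\<lambda>y. neg_log (u y)))"
  unfolding log_homogeneous_on_def
proof (intro allI impI ballI)
  fix \<alpha> :: real and p assume \<alpha>: "0 < \<alpha>"
  let ?g = "\<lambda>p z. ereal (- (p \<bullet> z)) - neg_log (u z)"
  have "X = (\<lambda>z. \<alpha> *\<^sub>R z) ` X"
  proof
    show "X \<subseteq> (\<lambda>z. \<alpha> *\<^sub>R z) ` X"
    proof
      fix z assume "z \<in> X"
      then have "inverse \<alpha> *\<^sub>R z \<in> X" "z = \<alpha> *\<^sub>R (inverse \<alpha> *\<^sub>R z)"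
        using \<alpha> by (simp_all add: scaled_in)
      then show "z \<in> (\<lambda>z. \<alpha> *\<^sub>R z) ` X"
        by blast
    qed
  qed (use \<alpha> scaled_in in auto)
  then have "(SUP z\<in>X. ?g p z) = (SUP z\<in>(\<lambda>z. \<alpha> *\<^sub>R z) ` X. ?g p z)"
    by (rule arg_cong)
  also have "\<dots> = (SUP z\<in>X. ?g p (\<alpha> *\<^sub>R z))"
    by (simp only: image_image)
  also have "\<dots> = (SUP z\<in>X. ?g (\<alpha> *\<^sub>R p) z + ereal (d * ln \<alpha>))"
  proof (rule SUP_cong[OF refl])
    fix z assume z: "z \<in> X"
    have "neg_log (u (\<alpha> *\<^sub>R z)) = neg_log (u z) - ereal (d * ln \<alpha>)"
      using utility_scaled[OF \<alpha> z] neg_log_mult[of "\<alpha> powr d" "u z"] \<alpha> u_nonneg[OF z]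
      by (simp add: ln_powr)
    then show "?g p (\<alpha> *\<^sub>R z) = ?g (\<alpha> *\<^sub>R p) z + ereal (d * ln \<alpha>)"
      by (cases "neg_log (u z)") auto
  qed
  also have "\<dots> = (SUP z\<in>X. ?g (\<alpha> *\<^sub>R p) z) + ereal (d * ln \<alpha>)"
    using zero_in by (intro SUP_ereal_add_left) auto
  finally show "conj_fun X (\<lambda>y. neg_log (u y)) (\<alpha> *\<^sub>R p)
      = conj_fun X (\<lambda>y. neg_log (u y)) p - ereal (d * ln \<alpha>)"
    unfolding conj_fun_def by (cases "SUP z\<in>X. ?g (\<alpha> *\<^sub>R p) z") auto
qed

section \<open>Continuity of the best response and the gradient\<close>

text \<open>A sequence of prices \<open>q n \<rightarrow> p\<close> whose best responses stay away from \<open>x p\<close> would have, by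
  boundedness, a limit point \<open>l\<close> of best responses. The budget constraint passes to the limit, and
  the rescaling inequality \<open>u (x p) \<le> (q n \<bullet> x p / w)\<^sup>d u (x (q n))\<close> passes to \<open>u (x p) \<le> u l\<close>, because
  \<open>p \<bullet> x p \<le> w\<close>. So \<open>l\<close> is a best response at \<open>p\<close>, against uniqueness.\<close>

lemma continuous_best_response:
  assumes X: "closed X" and cont: "continuous_on X u"
    and x: "\<And>p. p \<in> pos_orthant \<Longrightarrow> is_best_response X w u p (x p)"
  shows "continuous_on pos_orthant x"
  unfolding continuous_on_iff
proof (rule ccontr)
  assume "\<not> (\<forall>p\<in>pos_orthant. \<forall>e>0. \<exists>\<delta>>0. \<forall>q\<in>pos_orthant.
      dist q p < \<delta> \<longrightarrow> dist (x q) (x p) < e)"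
  then obtain p e where p: "p \<in> pos_orthant" and e: "0 < e"
    and far: "\<And>\<delta>. 0 < \<delta> \<Longrightarrow> \<exists>q\<in>pos_orthant. dist q p < \<delta> \<and> e \<le> dist (x q) (x p)"
    by (force simp: not_less)
  obtain m where m: "0 < m" "\<And>y. \<forall>i. 0 \<le> y $ i \<Longrightarrow> m * norm y \<le> p \<bullet> y"
    using pos_orthant_inner_ge[OF p] by blast
  \<comment> \<open>The radii tend to \<open>0\<close> and never exceed \<open>m / 2\<close>, so that \<open>q n \<bullet> y \<ge> (m / 2) norm y\<close> on the
    cone: this is what bounds the best responses uniformly.\<close>
  obtain q where q: "\<And>n. q n \<in> pos_orthant" "\<And>n. dist (q n) p < m / 2 / real (Suc n)"
      "\<And>n. e \<le> dist (x (q n)) (x p)"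
  proof -
    have "\<forall>n. \<exists>q\<in>pos_orthant. dist q p < m / 2 / real (Suc n) \<and> e \<le> dist (x q) (x p)"
      using far m(1) by simp
    then show ?thesis
      using that by metis
  qed
  have "(\<lambda>n. m / 2 / real (Suc n)) \<longlonglongrightarrow> 0"
    by (rule LIMSEQ_Suc[OF lim_const_over_n])
  then have q_lim: "q \<longlonglongrightarrow> p"
    by (rule metric_tendsto_imp_tendsto)
      (use q(2) m(1) in \<open>auto intro!: always_eventually less_imp_le\<close>)
  have xq: "x (q n) \<in> X" "q n \<bullet> x (q n) \<le> w" for n
    using best_response_in x q(1) by blast+
  have bound: "norm (x (q n)) \<le> 2 * w / m" for n
  proof -
    have "m / 2 / real (Suc n) \<le> m / 2"
      using m(1) by (simp add: field_simps)
    then have "norm (p - q n) \<le> m / 2"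
      using q(2)[of n] unfolding dist_norm norm_minus_commute[of p] by linarith
    then have "(p - q n) \<bullet> x (q n) \<le> m / 2 * norm (x (q n))"
      by (meson mult_right_mono norm_cauchy_schwarz norm_ge_zero order_trans)
    moreover have "m * norm (x (q n)) \<le> p \<bullet> x (q n)"
      using m(2) nonneg xq(1) by blast
    ultimately show ?thesis
      using xq(2)[of n] m(1) by (simp add: inner_diff_left field_simps)
  qed
  have "compact (X \<inter> cball 0 (2 * w / m))"
    using X by (simp add: closed_Int_compact)
  moreover have "\<forall>n. (x \<circ> q) n \<in> X \<inter> cball 0 (2 * w / m)"
    using xq bound by simp
  ultimately obtain l r where l: "l \<in> X" and r: "strict_mono r"
      and lim: "(\<lambda>n. x (q (r n))) \<longlonglongrightarrow> l"
    unfolding compact_def by (force simp: o_def)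
  have qr: "(\<lambda>n. q (r n)) \<longlonglongrightarrow> p"
    using LIMSEQ_subseq_LIMSEQ[OF q_lim r] by (simp add: o_def)
  have l_affordable: "p \<bullet> l \<le> w"
    by (rule LIMSEQ_le_const2[OF tendsto_inner[OF qr lim]]) (use xq(2) in auto)
  have xp: "x p \<in> X" "p \<bullet> x p \<le> w"
    using best_response_in x p by blast+
  have "u (x p) \<le> (p \<bullet> x p / w) powr d * u l"
  proof (rule LIMSEQ_le_const)
    have "(\<lambda>n. u (x (q (r n)))) \<longlonglongrightarrow> u l"
      using continuous_on_tendsto_compose[OF cont lim l] xq(1) by simp
    moreover have "(\<lambda>n. (q (r n) \<bullet> x p / w) powr d) \<longlonglongrightarrow> (p \<bullet> x p / w) powr d"
      using d w qr cost_nonneg[OF q(1) xp(1)]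
      by (intro tendsto_powr' tendsto_intros) auto
    ultimately show "(\<lambda>n. (q (r n) \<bullet> x p / w) powr d * u (x (q (r n))))
        \<longlonglongrightarrow> (p \<bullet> x p / w) powr d * u l"
      by (intro tendsto_mult)
    show "\<exists>N. \<forall>n\<ge>N. u (x p) \<le> (q (r n) \<bullet> x p / w) powr d * u (x (q (r n)))"
      using utility_le_rescaled_best[OF q(1) x[OF q(1)] xp(1)] by blast
  qed
  also have "\<dots> \<le> 1 * u l"
    using xp cost_nonneg[OF p xp(1)] w d u_nonneg[OF l]
    by (intro mult_right_mono powr_le1) auto
  finally have "u (x p) \<le> u l"
    by simp
  then have "l = x p"
    using x[OF p] l l_affordable by (simp add: is_best_response_iff)
  moreover have "e \<le> dist l (x p)"
    by (rule LIMSEQ_le_const[OF tendsto_dist[OF lim tendsto_const]]) (use q(3) in auto)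
  ultimately show False
    using e by simp
qed

lemma subgradient_ln_utility:
  assumes p: "p \<in> pos_orthant" and y: "is_best_response X w u p y"
    and q: "q \<in> pos_orthant" and z: "is_best_response X w u q z"
    and X: "X \<noteq> {0}"
  shows "(- (d / w) *\<^sub>R y) \<bullet> (q - p) \<le> ln (u z) - ln (u y)"
proof -
  have y': "y \<in> X" "y \<noteq> 0"
    using best_response_in best_response_nonzero p y X by blast+
  have "ln (q \<bullet> y / w) \<le> q \<bullet> y / w - 1"
    using cost_pos[OF q y'] w by (intro ln_le_minus_one) simp
  then have "d * ln (q \<bullet> y / w) \<le> d * (q \<bullet> y / w - 1)"
    using d by (intro mult_left_mono) auto
  also have "\<dots> = (d / w) * (y \<bullet> (q - p))"
    using best_response_spends_budget[OF p y X] w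
    by (simp add: inner_diff_right inner_commute field_simps)
  finally show ?thesis
    using ln_utility_le[OF q z y'] by simp
qed

lemma gderiv_dual_fun:
  assumes "closed X" "continuous_on X u" and X: "X \<noteq> {0}"
    and x: "\<And>p. p \<in> pos_orthant \<Longrightarrow> is_best_response X w u p (x p)"
    and p: "p \<in> pos_orthant"
  shows "GDERIV (\<lambda>q. real_of_ereal (dual_fun X w (\<lambda>y. neg_log (u y)) q)) p :> - (d / w) *\<^sub>R x p"
proof (rule gderiv_of_continuous_subgradient[OF open_pos_orthant p])
  show "continuous_on pos_orthant (\<lambda>q. - (d / w) *\<^sub>R x q)"
    by (intro continuous_intros continuous_best_response assms)
  show "(- (d / w) *\<^sub>R x a) \<bullet> (b - a)
      \<le> real_of_ereal (dual_fun X w (\<lambda>y. neg_log (u y)) b)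
        - real_of_ereal (dual_fun X w (\<lambda>y. neg_log (u y)) a)"
    if "a \<in> pos_orthant" "b \<in> pos_orthant" for a b
    using subgradient_ln_utility[OF that(1) x[OF that(1)] that(2) x[OF that(2)] X]
      dual_fun_eq_ln[OF that(1) x[OF that(1)] X] dual_fun_eq_ln[OF that(2) x[OF that(2)] X]
    by simp
qed

end

section \<open>The duality theorem\<close>

theorem lemma3p1:
  fixes X :: "(real ^ 'n) set"
    and u :: "real ^ 'n \<Rightarrow> real"
    and v :: "real ^ 'n \<Rightarrow> ereal"
    and x :: "real ^ 'n \<Rightarrow> real ^ 'n"
    and w d :: real
  assumes "closed X" and "convex_cone X" and "\<forall>y\<in>X. \<forall>i. 0 \<le> y $ i"
    and "0 < w"
    and "\<forall>y\<in>X. 0 \<le> u y"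
    and "u differentiable_on rel_interior X"
    and "strictly_concave_on X u"
    and "continuous_on X u"
    and "0 < d" and "homogeneous_on X d u"
    and "v = (\<lambda>y. neg_log (u y))"
    and "\<forall>p\<in>pos_orthant. is_best_response X w (\<lambda>y. - v y) p (x p)"
  shows "(\<forall>p\<in>pos_orthant. \<exists>y. is_arg_max (\<lambda>z. ereal (- (p \<bullet> z)) - v z) (\<lambda>z. z \<in> X) y)
    \<and> log_homogeneous_on pos_orthant d (conj_fun X v)
    \<and> (\<forall>p\<in>pos_orthant. dual_fun X w v p = conj_fun X v p + ereal (d + d * ln w - d * ln d))
    \<and> log_homogeneous_on pos_orthant d (dual_fun X w v)
    \<and> (\<forall>p\<in>pos_orthant. is_best_response X w u p (x p))
    \<and> (X \<noteq> {0} \<longrightarrow>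
         (\<forall>p\<in>pos_orthant. \<bar>dual_fun X w v p\<bar> \<noteq> \<infinity> \<and>
            GDERIV (\<lambda>q. real_of_ereal (dual_fun X w v q)) p :> - (d / w) *\<^sub>R x p))"
proof -
  interpret homogeneous_utility X u w d
    using assms by unfold_locales auto
  have v: "v = (\<lambda>y. neg_log (u y))"
    by (fact assms)
  have x: "is_best_response X w u p (x p)" if "p \<in> pos_orthant" for p
    using assms(12) that is_best_response_neg_log_iff[OF assms(5)] by (simp add: v)
  have dual: "dual_fun X w v p = conj_fun X v p + ereal (d + d * ln w - d * ln d)"
    if "p \<in> pos_orthant" for p
    using dual_fun_eq_conj_fun[OF that x[OF that]] by (simp add: v)
  have conj: "log_homogeneous_on pos_orthant d (conj_fun X v)"
    by (simp add: v log_homogeneous_conj_fun)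
  have "log_homogeneous_on pos_orthant d (dual_fun X w v)"
    unfolding log_homogeneous_on_def
  proof (intro allI impI ballI)
    fix \<alpha> :: real and p :: "real ^ 'n" assume \<alpha>: "0 < \<alpha>" and p: "p \<in> pos_orthant"
    then have "\<alpha> *\<^sub>R p \<in> pos_orthant"
      by (simp add: pos_orthant_def)
    then show "dual_fun X w v (\<alpha> *\<^sub>R p) = dual_fun X w v p - ereal (d * ln \<alpha>)"
      using conj \<alpha> p unfolding log_homogeneous_on_def
      by (cases "conj_fun X v p") (auto simp: dual)
  qed
  moreover have "\<forall>p\<in>pos_orthant. \<exists>y. is_arg_max (\<lambda>z. ereal (- (p \<bullet> z)) - v z) (\<lambda>z. z \<in> X) y"
    unfolding v using conj_fun_attained x by blast
  moreover have "\<bar>dual_fun X w v p\<bar> \<noteq> \<infinity>" if "X \<noteq> {0}" "p \<in> pos_orthant" for p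
    using dual_fun_eq_ln[OF that(2) x[OF that(2)] that(1)] by (simp add: v)
  moreover have "GDERIV (\<lambda>q. real_of_ereal (dual_fun X w v q)) p :> - (d / w) *\<^sub>R x p"
    if "X \<noteq> {0}" "p \<in> pos_orthant" for p
    using gderiv_dual_fun[OF assms(1) assms(8) that(1) x that(2)] by (simp add: v)
  ultimately show ?thesis
    using conj dual x by (intro conjI) auto
qed

end
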